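(* Let $\varphi_0$ be a constant $m\times m$ matrix with $[J,\varphi_0]=0$. Let $\boldsymbol{P}$ and $\boldsymbol{Q}$ be solutions of the $n\times n$ matrix equations $$\mathrm{i}\,\boldsymbol{P}_t+\boldsymbol{P}_y\,\boldsymbol{J}\,\boldsymbol{P}=0,\qquad \boldsymbol{P}_x=\tfrac12(\boldsymbol{J}\boldsymbol{P}\boldsymbol{J}-\boldsymbol{P})\,\boldsymbol{P},$$ $$\mathrm{i}\,\boldsymbol{Q}_t+\boldsymbol{Q}\,\boldsymbol{J}\,\boldsymbol{Q}_y=0,\qquad \boldsymbol{Q}_x=\tfrac12\boldsymbol{Q}\,(\boldsymbol{Q}-\boldsymbol{J}\boldsymbol{Q}\boldsymbol{J}),$$ and assume that $\sigma(\boldsymbol{J}\boldsymbol{P})\cap\sigma(\boldsymbol{Q}\boldsymbol{J})=\emptyset$ (at every point). Let $\boldsymbol{X}$ be the unique solution of the Sylvester equation $$\boldsymbol{X}\,(\boldsymbol{J}\boldsymbol{P})-(\boldsymbol{Q}\boldsymbol{J})\,\boldsymbol{X}=\boldsymbol{V}_0\,\boldsymbol{U}_0,$$ where $\boldsymbol{U}_0$ and $\boldsymbol{V}_0$ are constant matrices of size $m\times n$, respectively $n\times m$, satisfying $J\boldsymbol{U}_0=\boldsymbol{U}_0\boldsymbol{J}$ and $\boldsymbol{J}\boldsymbol{V}_0=\boldsymbol{V}_0J$. Then $$\varphi=\varphi_0+J\,\boldsymbol{U}_0\,\boldsymbol{X}^{-1}\,\boldsymbol{V}_0$$ (except at singular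 points, i.e. on the set where $\boldsymbol{X}$ is invertible) solves $$-\frac{\mathrm{i}}{2}[J,\varphi_t]=\varphi_{xy}+\frac12\Big(\varphi_y\,J\,[J,\varphi]-[J,\varphi]\,J\,\varphi_y\Big).$$
   Context: All matrices have entries that are smooth complex functions of real variables $x,y,t$ (on an open domain); subscripts $x,y,t$ denote partial derivatives; "constant" means independent of $x,y,t$. $m=m_1+m_2$ and $J=\begin{pmatrix}I_{m_1}&0\\0&-I_{m_2}\end{pmatrix}$. $\boldsymbol{J}$ is an $n\times n$ counterpart of $J$: a constant diagonal matrix with entries $\pm1$ on the diagonal (so $\boldsymbol{J}^2=I_n$). $\sigma(\cdot)$ denotes the spectrum of a matrix. *)

theory Defs
  imports "HOL-Analysis.Analysis"
begin

text \<open>A point \<open>(x, y, t)\<close> of the underlying three-dimensional real space.\<close>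

type_synonym point = "real \<times> real \<times> real"

text \<open>
  The three partial derivatives. As usual for \<^const>\<open>vector_derivative\<close>, the values are
  meaningful only where the partial derivative exists; this is ensured by \<open>smooth_on\<close> below.
\<close>

definition pd_x :: "(point \<Rightarrow> 'a::real_normed_vector) \<Rightarrow> point \<Rightarrow> 'a" where
  "pd_x f = (\<lambda>(x, y, t). vector_derivative (\<lambda>s. f (s, y, t)) (at x))"

definition pd_y :: "(point \<Rightarrow> 'a::real_normed_vector) \<Rightarrow> point \<Rightarrow> 'a" where
  "pd_y f = (\<lambda>(x, y, t). vector_derivative (\<lambda>s. f (x, s, t)) (at y))"

definition pd_t :: "(point \<Rightarrow> 'a::real_normed_vector) \<Rightarrow> point \<Rightarrow> 'a" where
  "pd_t f = (\<lambda>(x, y, t). vector_derivative (\<lambda>s. f (x, y, s)) (at t))"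

definition has_partials_at :: "(point \<Rightarrow> 'a::real_normed_vector) \<Rightarrow> point \<Rightarrow> bool" where
  "has_partials_at f = (\<lambda>(x, y, t).
     (\<lambda>s. f (s, y, t)) differentiable (at x) \<and>
     (\<lambda>s. f (x, s, t)) differentiable (at y) \<and>
     (\<lambda>s. f (x, y, s)) differentiable (at t))"

primrec Ck_on :: "nat \<Rightarrow> (point \<Rightarrow> 'a::real_normed_vector) \<Rightarrow> point set \<Rightarrow> bool" where
  "Ck_on 0 f S \<longleftrightarrow> continuous_on S f"
| "Ck_on (Suc k) f S \<longleftrightarrow>
     continuous_on S f \<and> (\<forall>p\<in>S. has_partials_at f p) \<and>
     Ck_on k (pd_x f) S \<and> Ck_on k (pd_y f) S \<and> Ck_on k (pd_t f) S"

text \<open>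
  Intended for open \<open>S\<close>: all iterated partial derivatives exist and are continuous on \<open>S\<close>.
  For a matrix-valued function this is the same as smoothness of all entries.
\<close>

definition smooth_on :: "point set \<Rightarrow> (point \<Rightarrow> 'a::real_normed_vector) \<Rightarrow> bool" where
  "smooth_on S f \<longleftrightarrow> (\<forall>k. Ck_on k f S)"

definition cscale :: "complex \<Rightarrow> complex^'k^'l \<Rightarrow> complex^'k^'l" (infixr \<open>*\<^sub>c\<close> 75) where
  "c *\<^sub>c A = (\<chi> i j. c * A $ i $ j)"

definition commutator :: "complex^'k^'k \<Rightarrow> complex^'k^'k \<Rightarrow> complex^'k^'k" where
  "commutator A B = A ** B - B ** A"

text \<open>The block matrix \<open>diag(I, -I)\<close>, with block sizes \<open>CARD('m1)\<close> and \<open>CARD('m2)\<close>.\<close>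

definition block_J :: "complex^('m1::finite + 'm2::finite)^('m1 + 'm2)" where
  "block_J = (\<chi> i j. if i = j then (case i of Inl _ \<Rightarrow> 1 | Inr _ \<Rightarrow> - 1) else 0)"

definition diagonal_pm1 :: "complex^'n^'n \<Rightarrow> bool" where
  "diagonal_pm1 A \<longleftrightarrow>
     (\<forall>i j. i \<noteq> j \<longrightarrow> A $ i $ j = 0) \<and> (\<forall>i. A $ i $ i = 1 \<or> A $ i $ i = - 1)"

definition spectrum :: "complex^'n^'n \<Rightarrow> complex set" where
  "spectrum A = {c. \<exists>v. v \<noteq> 0 \<and> A *v v = c *s v}"

definition is_sylvester_solution ::
    "complex^'n^'n \<Rightarrow> complex^'n^'n \<Rightarrow> complex^'n^'n \<Rightarrow> complex^'n^'n \<Rightarrow> bool" where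
  "is_sylvester_solution A B C X \<longleftrightarrow> X ** A - B ** X = C"

text \<open>Meaningful only if the equation has exactly one solution.\<close>

definition sylvester_solution ::
    "complex^'n^'n \<Rightarrow> complex^'n^'n \<Rightarrow> complex^'n^'n \<Rightarrow> complex^'n^'n" where
  "sylvester_solution A B C = (THE X. is_sylvester_solution A B C X)"

end

theory Submission
  imports Defs "HOL-Computational_Algebra.Fundamental_Theorem_Algebra"
begin

text \<open>Put \<open>A = \<^bold>J P\<close>, \<open>B = Q \<^bold>J\<close>, \<open>C = V\<^sub>0 U\<^sub>0\<close> and \<open>W = X\<^sup>-\<^sup>1\<close>. Differentiating \<open>X A - B X = C\<close> gives Sylvester
  equations with the same coefficients for the derivatives of \<open>X\<close>. As \<open>A\<close> and \<open>B\<close> have disjoint spectra,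
  their solutions are unique, and the equations for \<open>P\<close> and \<open>Q\<close> yield
  \<open>X\<^sub>x = (B \<^bold>J X - X \<^bold>J A + C \<^bold>J) / 2\<close> and \<open>\<i> X\<^sub>t = X A\<^sub>y - B X\<^sub>y\<close>. Together with \<open>W B = A W - W C W\<close>, these
  express \<open>\<phi>\<^sub>x\<close> and \<open>\<phi>\<^sub>t\<close> through \<open>F = A W\<close> and \<open>W\<close>:
  \<open>-\<i> W\<^sub>t = F\<^sub>y - W C W\<^sub>y\<close> and \<open>-2 \<phi>\<^sub>x = U\<^sub>0 \<^bold>J (F \<^bold>J - W C W \<^bold>J - \<^bold>J F + W C \<^bold>J W) V\<^sub>0\<close>.
  Since \<open>\<phi>\<^sub>x\<close> contains no derivatives, \<open>\<phi>\<^sub>x\<^sub>y\<close> follows by the product rule without mixed derivatives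
  of \<open>P\<close> and \<open>Q\<close>, and in the equation for \<open>\<phi>\<close> all terms cancel.\<close>

section \<open>Uniqueness for the Sylvester equation\<close>

text \<open>The vector \<open>p(B) w\<close>.\<close>

definition krylov :: "'a::field^'n^'n \<Rightarrow> 'a^'n \<Rightarrow> 'a poly \<Rightarrow> 'a^'n" where
  "krylov B w p = fold_coeffs (\<lambda>a v. a *s w + B *v v) p 0"

lemma krylov_0 [simp]: "krylov B w 0 = 0"
  by (simp add: krylov_def)

lemma krylov_pCons [simp]: "krylov B w (pCons a p) = a *s w + B *v krylov B w p"
  by (cases "p = 0 \<and> a = 0") (auto simp: krylov_def)

lemma krylov_add: "krylov B w (p + q) = krylov B w p + krylov B w q"
  by (induction p q rule: poly_induct2)
    (simp_all add: matrix_vector_right_distrib vec.scale_left_distrib)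

lemma krylov_smult: "krylov B w (smult c p) = c *s krylov B w p"
  by (induction p)
    (simp_all add: vec.scale_right_distrib vec.scale)

lemma krylov_sum: "krylov B w (\<Sum>i\<in>I. f i) = (\<Sum>i\<in>I. krylov B w (f i))"
  by (induction I rule: infinite_finite_induct) (simp_all add: krylov_add)

lemma krylov_diff: "krylov B w (p - q) = krylov B w p - krylov B w q"
  using krylov_add[of B w "p - q" q] by simp

text \<open>A root \<open>c\<close> of a polynomial becomes a factor \<open>B - c\<close>, so a
  vanishing \<open>krylov\<close> vector yields an eigenvector equation.\<close>

lemma krylov_linear_factor:
  "krylov B w ([:- c, 1:] * q) = B *v krylov B w q - c *s krylov B w q"
  by (simp add: krylov_diff krylov_smult)

lemma krylov_in_invariant:
  assumes "vec.subspace W" "\<And>v. v \<in> W \<Longrightarrow> B *v v \<in> W" "w \<in> W"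
  shows "krylov B w p \<in> W"
  using assms
  by (induction p) (auto simp: vec.subspace_0 vec.subspace_add vec.subspace_scale)

text \<open>\<open>CARD('n) + 1\<close> iterates of \<open>w\<close> under \<open>B\<close> cannot
  be independent; the coefficients of a linear relation form the polynomial.\<close>

lemma krylov_annihilator:
  fixes B :: "'a::field^'n^'n"
  shows "\<exists>p. p \<noteq> 0 \<and> krylov B w p = 0"
proof -
  define v where "v i = krylov B w (monom 1 i)" for i :: nat
  \<comment> \<open>Dependence of a set does not see repetitions, so \<open>v i = v j\<close> with
    \<open>i \<noteq> j\<close> is a separate case.\<close>
  show ?thesis
  proof (cases "inj_on v {..CARD('n)}")
    case False
    then obtain i j where ij: "i \<noteq> j" "v i = v j"
      by (auto simp: inj_on_def)
    have "coeff (monom (1::'a) i - monom 1 j) i \<noteq> 0"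
      using ij by simp
    then have "monom (1::'a) i - monom 1 j \<noteq> 0"
      by (metis coeff_0)
    moreover have "krylov B w (monom 1 i - monom 1 j) = 0"
      using ij by (simp add: krylov_diff v_def)
    ultimately show ?thesis by blast
  next
    case True
    have "CARD('n) < card (v ` {..CARD('n)})"
      using True by (simp add: card_image)
    moreover have "vec.dim (v ` {..CARD('n)}) \<le> CARD('n)"
      by (rule dim_subset_UNIV_cart_gen)
    ultimately have "vec.dependent (v ` {..CARD('n)})"
      by (intro vec.dependent_biggerset_general) auto
    then obtain u x where x: "x \<in> v ` {..CARD('n)}" "u x \<noteq> 0"
      and u: "(\<Sum>x\<in>v ` {..CARD('n)}. u x *s x) = 0"
      by (auto simp: vec.dependent_finite)
    then obtain k where k: "k \<le> CARD('n)" "u (v k) \<noteq> 0" by auto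
    let ?p = "\<Sum>i\<le>CARD('n). smult (u (v i)) (monom 1 i)"
    have "coeff ?p k = u (v k)"
      using k by (simp add: coeff_sum if_distrib cong: if_cong)
    with k have "?p \<noteq> 0" by (metis coeff_0)
    moreover have "krylov B w ?p = (\<Sum>i\<le>CARD('n). u (v i) *s v i)"
      by (simp add: krylov_sum krylov_smult v_def)
    then have "krylov B w ?p = 0"
      using u by (simp add: sum.reindex[OF True])
    ultimately show ?thesis by blast
  qed
qed

text \<open>For an annihilating polynomial \<open>[:- c, 1:] * q\<close> of least degree,
  \<open>krylov B w q\<close> is nonzero by minimality, lies in \<open>W\<close> by invariance, and
  is killed by \<open>B - c\<close>.\<close>

lemma invariant_subspace_eigenvector:
  fixes B :: "complex^'n^'n"
  assumes W: "vec.subspace W" "\<And>v. v \<in> W \<Longrightarrow> B *v v \<in> W" and w: "w \<in> W" "w \<noteq> 0"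
  obtains v c where "v \<in> W" "v \<noteq> 0" "B *v v = c *s v"
proof -
  let ?A = "\<lambda>p. p \<noteq> 0 \<and> krylov B w p = 0"
  obtain p where p: "?A p" and min: "\<And>q. ?A q \<Longrightarrow> degree p \<le> degree q"
    using krylov_annihilator[of B w] ex_has_least_nat[of ?A _ degree] by blast
  have "degree p \<noteq> 0"
  proof
    assume "degree p = 0"
    then obtain a where "p = [:a:]" by (metis degree_eq_zeroE)
    with p w show False by (simp add: vec.scale_eq_0_iff)
  qed
  then obtain c where "poly p c = 0"
    using fundamental_theorem_of_algebra[of p] by (auto simp: constant_degree)
  then obtain q where q: "p = [:- c, 1:] * q"
    by (metis dvdE poly_eq_0_iff_dvd)
  with p have "q \<noteq> 0" by auto
  then have "degree q < degree p"
    unfolding q by (subst degree_mult_eq) auto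
  then have "krylov B w q \<noteq> 0"
    using min \<open>q \<noteq> 0\<close> not_less by blast
  moreover have "B *v krylov B w q = c *s krylov B w q"
    using p unfolding q krylov_linear_factor by simp
  ultimately show ?thesis
    using that krylov_in_invariant[OF W w(1)] by blast
qed

text \<open>An eigenvector \<open>Y v\<close> of \<open>B\<close> in the range of \<open>Y\<close>, with eigenvalue \<open>c\<close>, gives \<open>(A - c) v \<in> ker Y\<close>.
  If \<open>c\<close> is no eigenvalue of \<open>A\<close>, then \<open>A - c\<close> maps the \<open>A\<close>-invariant subspace \<open>ker Y\<close> onto itself,
  so \<open>v \<in> ker Y\<close>.\<close>

lemma sylvester_homogeneous:
  fixes A B Y :: "complex^'n^'n"
  assumes disj: "spectrum A \<inter> spectrum B = {}" and Y: "Y ** A = B ** Y"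
  shows "Y = 0"
proof (rule ccontr)
  assume "Y \<noteq> 0"
  then obtain u where u: "Y *v u \<noteq> 0"
    by (metis matrix_eq matrix_vector_mult_0)
  have YA: "Y *v (A *v v) = B *v (Y *v v)" for v
    by (simp add: matrix_vector_mul_assoc Y)
  have "vec.subspace (range ((*v) Y))"
    by (simp add: vec.subspace_image)
  then obtain w c where "w \<in> range ((*v) Y)" "w \<noteq> 0" "B *v w = c *s w"
    by (rule invariant_subspace_eigenvector[where B=B and w="Y *v u"]) (use u YA in \<open>auto simp flip: YA\<close>)
  then obtain v where v: "Y *v v \<noteq> 0" "B *v (Y *v v) = c *s (Y *v v)" by auto
  then have "c \<notin> spectrum A"
    using disj by (auto simp: spectrum_def)
  then have no_eig: "x = 0" if "A *v x = c *s x" for x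
    using that by (auto simp: spectrum_def)
  let ?K = "{x. Y *v x = 0}"
  let ?M = "A - mat c"
  have mat_c: "mat c *v x = c *s x" for x :: "complex^'n"
    by (simp add: vec_eq_iff mat_def matrix_vector_mult_def if_distrib[of "\<lambda>z. z * _"] cong: if_cong)
  have M: "?M *v x = A *v x - c *s x" for x
    by (simp add: matrix_vector_mult_diff_rdistrib mat_c)
  have inj: "inj ((*v) ?M)"
    unfolding vec.inj_iff_eq_0 using no_eig by (simp add: M)
  have K: "vec.subspace ?K"
    by (simp add: vec.subspace_kernel)
  have "?M *v x \<in> ?K" if "x \<in> ?K" for x
    using that by (simp add: M vec.diff vec.scale YA)
  then have "(*v) ?M ` ?K \<subseteq> ?K" by blast
  \<comment> \<open>Injectivity preserves dimension, so the image of the kernel cannot be a proper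
    subspace of it.\<close>
  moreover have "vec.dim ((*v) ?M ` ?K) = vec.dim ?K"
    by (rule vec.dim_image_eq) (use inj in \<open>auto intro: inj_on_subset\<close>)
  ultimately have "(*v) ?M ` ?K = ?K"
    using K by (intro vec.subspace_dim_equal) (auto simp: vec.subspace_image)
  moreover have "?M *v v \<in> ?K"
    using v by (simp add: M vec.diff vec.scale YA)
  ultimately obtain x where "x \<in> ?K" "?M *v v = ?M *v x" by blast
  with inj have "v \<in> ?K" by (metis injD)
  with v show False by simp
qed

section \<open>Smooth solutions of linear equations with parameters\<close>

definition axes :: "point set" where
  "axes = {(1, 0, 0), (0, 1, 0), (0, 0, 1)}"

text \<open>With \<open>e\<close> in \<open>axes\<close>, one argument covers all three partial
  derivatives.\<close>

definition pd :: "point \<Rightarrow> (point \<Rightarrow> 'a::real_normed_vector) \<Rightarrow> point \<Rightarrow> 'a" where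
  "pd e f p = vector_derivative (\<lambda>s. f (p + s *\<^sub>R e)) (at 0)"

definition has_pd :: "point \<Rightarrow> (point \<Rightarrow> 'a::real_normed_vector) \<Rightarrow> 'a \<Rightarrow> point \<Rightarrow> bool" where
  "has_pd e f d p \<longleftrightarrow> ((\<lambda>s. f (p + s *\<^sub>R e)) has_vector_derivative d) (at 0)"

text \<open>Difference quotients are the form needed later: those of a solution of a linear equation
  solve linear equations themselves.\<close>

lemma has_vector_derivative_iff_slope:
  "(f has_vector_derivative d) (at 0) \<longleftrightarrow> ((\<lambda>s. (f s - f 0) /\<^sub>R s) \<longlongrightarrow> d) (at 0)"
proof -
  have "norm ((f s - f 0) /\<^sub>R s - d) = norm (f (0 + s) - f 0 - s *\<^sub>R d) / norm s" if "s \<noteq> 0" for s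
  proof -
    have "(f s - f 0) /\<^sub>R s - d = (f (0 + s) - f 0 - s *\<^sub>R d) /\<^sub>R s"
      using that by (simp add: scaleR_diff_right)
    then show ?thesis by (simp add: divide_inverse mult.commute)
  qed
  then have "((\<lambda>s. norm ((f s - f 0) /\<^sub>R s - d)) \<longlongrightarrow> 0) (at 0) \<longleftrightarrow>
      ((\<lambda>s. norm (f (0 + s) - f 0 - s *\<^sub>R d) / norm s) \<longlongrightarrow> 0) (at 0)"
    by (intro tendsto_cong) (auto simp: eventually_at_filter)
  then show ?thesis
    by (simp add: has_vector_derivative_def has_derivative_at bounded_linear_scaleR_left
        tendsto_norm_zero_iff LIM_zero_iff)
qed

lemma has_vector_derivative_at_shift:
  "(f has_vector_derivative d) (at x) \<longleftrightarrow> ((\<lambda>s. f (x + s)) has_vector_derivative d) (at 0)"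
proof
  have "((+) x has_vector_derivative 1) (at 0)"
    by (auto intro!: derivative_eq_intros)
  moreover assume "(f has_vector_derivative d) (at x)"
  ultimately show "((\<lambda>s. f (x + s)) has_vector_derivative d) (at 0)"
    using vector_diff_chain_at[of "\<lambda>s. x + s" 1 0 f d]
    by (simp add: o_def)
next
  have "((\<lambda>s. s - x) has_vector_derivative 1) (at x)"
    by (auto intro!: derivative_eq_intros)
  moreover assume "((\<lambda>s. f (x + s)) has_vector_derivative d) (at 0)"
  ultimately show "(f has_vector_derivative d) (at x)"
    using vector_diff_chain_at[of "\<lambda>s. s - x" 1 x "\<lambda>s. f (x + s)" d]
    by (simp add: o_def)
qed

lemma has_pdD: "has_pd e f d p \<Longrightarrow> pd e f p = d"
  by (simp add: has_pd_def pd_def vector_derivative_at)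

lemma differentiable_iff_has_vector_derivative:
  "f differentiable F \<longleftrightarrow> (\<exists>d. (f has_vector_derivative d) F)"
  using vector_derivative_works differentiableI_vector by blast

lemma has_pd_pd: "has_pd e f d p \<Longrightarrow> has_pd e f (pd e f p) p"
  by (simp add: has_pdD)

lemma pd_x_eq: "pd_x f = pd (1, 0, 0) f"
  and pd_y_eq: "pd_y f = pd (0, 1, 0) f"
  and pd_t_eq: "pd_t f = pd (0, 0, 1) f"
  by (auto simp: fun_eq_iff pd_x_def pd_y_def pd_t_def pd_def vector_derivative_def
      has_vector_derivative_at_shift[of "\<lambda>s. f (s, _)"] has_vector_derivative_at_shift[of "\<lambda>s. f (_, s, _)"]
      has_vector_derivative_at_shift[of "\<lambda>s. f (_, _, s)"])

lemma has_partials_at_iff: "has_partials_at f p \<longleftrightarrow> (\<forall>e\<in>axes. \<exists>d. has_pd e f d p)"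
  by (cases p) (auto simp: axes_def has_partials_at_def differentiable_iff_has_vector_derivative has_pd_def
      has_vector_derivative_at_shift[of "\<lambda>s. f (s, _)"] has_vector_derivative_at_shift[of "\<lambda>s. f (_, s, _)"]
      has_vector_derivative_at_shift[of "\<lambda>s. f (_, _, s)"])

lemma Ck_on_Suc_iff:
  "Ck_on (Suc k) f S \<longleftrightarrow>
     continuous_on S f \<and> (\<forall>e\<in>axes. (\<forall>p\<in>S. has_pd e f (pd e f p) p) \<and> Ck_on k (pd e f) S)"
  using has_pd_pd by (fastforce simp: has_partials_at_iff pd_x_eq pd_y_eq pd_t_eq axes_def)

lemma Ck_on_continuous: "Ck_on k f S \<Longrightarrow> continuous_on S f"
  by (cases k) auto

lemma Ck_on_SucD: "Ck_on (Suc k) f S \<Longrightarrow> Ck_on k f S"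
  by (induction k arbitrary: f) (auto simp: Ck_on_Suc_iff simp del: Ck_on.simps(2))

lemma Ck_on_subset: "Ck_on k f S \<Longrightarrow> T \<subseteq> S \<Longrightarrow> Ck_on k f T"
  by (induction k arbitrary: f) (auto intro: continuous_on_subset)

lemma eventually_line:
  fixes p e :: point
  assumes "open S" "p \<in> S"
  shows "eventually (\<lambda>s. p + s *\<^sub>R e \<in> S) (at (0::real))"
proof -
  have "((\<lambda>s. p + s *\<^sub>R e) \<longlongrightarrow> p + 0 *\<^sub>R e) (at (0::real))"
    by (intro tendsto_intros)
  then show ?thesis
    using topological_tendstoD[OF _ assms(1)] assms(2) by fastforce
qed

text \<open>For small \<open>s\<close> the line through \<open>p\<close> stays in the open set, so
  identities known only on \<open>S\<close> can be differentiated.\<close>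

lemma has_pd_cong:
  assumes "open S" "p \<in> S" "\<And>q. q \<in> S \<Longrightarrow> f q = g q"
  shows "has_pd e f d p \<longleftrightarrow> has_pd e g d p"
  unfolding has_pd_def has_vector_derivative_iff_slope
proof (rule tendsto_cong)
  show "\<forall>\<^sub>F s in at 0. (f (p + s *\<^sub>R e) - f (p + 0 *\<^sub>R e)) /\<^sub>R s = (g (p + s *\<^sub>R e) - g (p + 0 *\<^sub>R e)) /\<^sub>R s"
    using eventually_line[OF assms(1,2), of e] by eventually_elim (simp add: assms(2,3))
qed

lemma pd_cong:
  assumes "open S" "p \<in> S" "\<And>q. q \<in> S \<Longrightarrow> f q = g q"
  shows "pd e f p = pd e g p"
  unfolding pd_def vector_derivative_def
  by (rule arg_cong[where f = Eps]) (use has_pd_cong[where f = f and g = g, OF assms] in \<open>simp add: fun_eq_iff has_pd_def\<close>)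

lemma Ck_on_cong:
  assumes "open S" "\<And>q. q \<in> S \<Longrightarrow> f q = g q"
  shows "Ck_on k f S \<longleftrightarrow> Ck_on k g S"
  using assms(2)
proof (induction k arbitrary: f g)
  case 0
  then show ?case by (simp cong: continuous_on_cong)
next
  case (Suc k)
  have *: "Ck_on k (pd e f) S \<longleftrightarrow> Ck_on k (pd e g) S" for e
    by (rule Suc.IH) (use pd_cong[OF assms(1)] Suc.prems in blast)
  have "has_pd e f (pd e f p) p \<longleftrightarrow> has_pd e g (pd e g p) p" if "p \<in> S" for e p
    using has_pd_cong[OF assms(1) that Suc.prems] pd_cong[OF assms(1) that Suc.prems] by simp
  moreover have "continuous_on S f \<longleftrightarrow> continuous_on S g"
    using Suc.prems by (simp cong: continuous_on_cong)
  ultimately show ?case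
    unfolding Ck_on_Suc_iff using * by simp
qed

text \<open>The derivative may be given by any formula \<open>f'\<close>, since it agrees with
  \<open>pd e f\<close> on the open set \<open>S\<close>.\<close>

lemma Ck_on_SucI:
  assumes "open S" "continuous_on S f"
    and "\<And>e p. e \<in> axes \<Longrightarrow> p \<in> S \<Longrightarrow> has_pd e f (f' e p) p"
    and "\<And>e. e \<in> axes \<Longrightarrow> Ck_on k (f' e) S"
  shows "Ck_on (Suc k) f S"
  unfolding Ck_on_Suc_iff
proof (intro conjI ballI)
  fix e assume e: "e \<in> axes"
  show "Ck_on k (pd e f) S"
    using assms(3,4) e by (subst Ck_on_cong[OF assms(1), where g = "f' e"]) (auto simp: has_pdD)
qed (use assms(2,3) has_pd_pd in blast)+

section \<open>Differentiation rules and closure of the Ck classes\<close>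

lemma has_pd_const [intro]: "has_pd e (\<lambda>p. c) 0 p"
  by (simp add: has_pd_def)

lemma has_pd_add:
  "has_pd e f f' p \<Longrightarrow> has_pd e g g' p \<Longrightarrow> has_pd e (\<lambda>p. f p + g p) (f' + g') p"
  unfolding has_pd_def by (rule has_vector_derivative_add)

lemma has_pd_diff:
  "has_pd e f f' p \<Longrightarrow> has_pd e g g' p \<Longrightarrow> has_pd e (\<lambda>p. f p - g p) (f' - g') p"
  unfolding has_pd_def by (rule has_vector_derivative_diff)

lemma (in bounded_linear) has_pd:
  "has_pd e g g' p \<Longrightarrow> has_pd e (\<lambda>p. f (g p)) (f g') p"
  unfolding has_pd_def by (rule has_vector_derivative)

lemma (in bounded_bilinear) has_pd:
  "has_pd e f f' p \<Longrightarrow> has_pd e g g' p \<Longrightarrow>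
    has_pd e (\<lambda>p. prod (f p) (g p)) (prod (f p) g' + prod f' (g p)) p"
  using has_vector_derivative[of "\<lambda>s. f (p + s *\<^sub>R e)" f' 0 UNIV "\<lambda>s. g (p + s *\<^sub>R e)" g']
  by (simp add: has_pd_def)

lemma Ck_on_has_pd: "Ck_on (Suc k) f S \<Longrightarrow> e \<in> axes \<Longrightarrow> p \<in> S \<Longrightarrow> has_pd e f (pd e f p) p"
  and Ck_on_pd: "Ck_on (Suc k) f S \<Longrightarrow> e \<in> axes \<Longrightarrow> Ck_on k (pd e f) S"
  by (auto simp: Ck_on_Suc_iff simp del: Ck_on.simps(2))

lemma Ck_on_const: "open S \<Longrightarrow> Ck_on k (\<lambda>p. c) S"
  by (induction k arbitrary: c) (auto intro!: Ck_on_SucI[where f' = "\<lambda>_ _. 0"] simp del: Ck_on.simps(2))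

lemma Ck_on_add:
  assumes "open S" "Ck_on k f S" "Ck_on k g S"
  shows "Ck_on k (\<lambda>p. f p + g p) S"
  using assms(2,3)
proof (induction k arbitrary: f g)
  case (Suc k)
  show ?case
    by (rule Ck_on_SucI[OF assms(1), where f' = "\<lambda>e p. pd e f p + pd e g p"])
      (intro continuous_on_add has_pd_add Suc.IH Ck_on_continuous[OF Suc.prems(1)]
        Ck_on_continuous[OF Suc.prems(2)] Ck_on_has_pd[OF Suc.prems(1)] Ck_on_has_pd[OF Suc.prems(2)]
        Ck_on_pd[OF Suc.prems(1)] Ck_on_pd[OF Suc.prems(2)]; assumption)+
qed (simp add: continuous_on_add)

lemma (in bounded_linear) Ck_on:
  assumes "open S" "Ck_on k g S"
  shows "Ck_on k (\<lambda>p. f (g p)) S"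
  using assms(2)
proof (induction k arbitrary: g)
  case (Suc k)
  show ?case
    by (rule Ck_on_SucI[OF assms(1), where f' = "\<lambda>e p. f (pd e g p)"])
      (intro continuous_on has_pd Suc.IH Ck_on_continuous[OF Suc.prems]
        Ck_on_has_pd[OF Suc.prems] Ck_on_pd[OF Suc.prems]; assumption)+
qed (simp add: continuous_on)

lemma (in bounded_bilinear) Ck_on:
  assumes "open S" "Ck_on k f S" "Ck_on k g S"
  shows "Ck_on k (\<lambda>p. prod (f p) (g p)) S"
  using assms(2,3)
proof (induction k arbitrary: f g)
  case (Suc k)
  show ?case
  proof (rule Ck_on_SucI[OF assms(1), where f' = "\<lambda>e p. prod (f p) (pd e g p) + prod (pd e f p) (g p)"])
    \<comment> \<open>The product rule leaves one factor undifferentiated; its class k + 1 is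
      lowered to k for the induction hypothesis.\<close>
    show "Ck_on k (\<lambda>p. prod (f p) (pd e g p) + prod (pd e f p) (g p)) S" if "e \<in> axes" for e
      using Suc that by (intro Ck_on_add[OF assms(1)] Suc.IH) (auto intro: Ck_on_SucD Ck_on_pd simp del: Ck_on.simps(2))
  qed (intro continuous_on has_pd Ck_on_continuous[OF Suc.prems(1)] Ck_on_continuous[OF Suc.prems(2)]
      Ck_on_has_pd[OF Suc.prems(1)] Ck_on_has_pd[OF Suc.prems(2)]; assumption)+
qed (simp add: continuous_on)

text \<open>Linear equations \<open>prod (a p) (z p) = C p\<close> with parameters. The instances are the Sylvester equation,
  with coefficient pair \<open>(A, B)\<close>, and the equation \<open>X ** Y = mat 1\<close> for the inverse matrix.\<close>

locale euclidean_bilinear = bounded_bilinear prod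
  for prod :: "'a::real_normed_vector \<Rightarrow> 'b::euclidean_space \<Rightarrow> 'b"
begin

definition nonsingular :: "'a \<Rightarrow> bool" where
  "nonsingular a \<longleftrightarrow> (\<forall>z. prod a z = 0 \<longrightarrow> z = 0)"

text \<open>\<open>prod a\<^sub>0\<close> is injective and linear in finite dimension, hence bounded
  below by some \<open>b\<close>; moving \<open>a\<^sub>0\<close> by less than
  \<open>b / (2 * K)\<close> loses at most half of that bound.\<close>

lemma nonsingular_bounded_below:
  assumes "nonsingular a\<^sub>0"
  shows "\<exists>c>0. \<exists>r>0. \<forall>a z. dist a a\<^sub>0 < r \<longrightarrow> c * norm z \<le> norm (prod a z)"
proof -
  have "linear (prod a\<^sub>0)"
    using bounded_linear_right by (rule bounded_linear.linear)
  moreover from this have "inj (prod a\<^sub>0)"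
    using assms by (auto simp: linear_injective_0 nonsingular_def)
  ultimately obtain b where b: "b > 0" "\<And>z. b * norm z \<le> norm (prod a\<^sub>0 z)"
    using linear_inj_bounded_below_pos by blast
  obtain K where K: "K > 0" "\<And>a z. norm (prod a z) \<le> norm a * norm z * K"
    using pos_bounded by blast
  have "b / 2 * norm z \<le> norm (prod a z)" if "dist a a\<^sub>0 < b / (2 * K)" for a z
  proof -
    have "norm (prod (a - a\<^sub>0) z) \<le> norm (a - a\<^sub>0) * norm z * K"
      by (rule K)
    also have "\<dots> = (norm (a - a\<^sub>0) * K) * norm z" by simp
    also have "\<dots> \<le> b / 2 * norm z"
      using that K(1) by (intro mult_right_mono) (auto simp: dist_norm field_simps)
    finally have "norm (prod (a - a\<^sub>0) z) \<le> b / 2 * norm z" .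
    moreover have "norm (prod a\<^sub>0 z) \<le> norm (prod a z) + norm (prod (a - a\<^sub>0) z)"
      using norm_triangle_ineq4[of "prod a z" "prod (a - a\<^sub>0) z"] by (simp add: diff_left)
    ultimately show ?thesis using b(2)[of z] by (simp add: field_simps)
  qed
  then show ?thesis
    using b K by (intro exI[of _ "b / 2"] exI[of _ "b / (2 * K)"] conjI) simp_all
qed

lemma open_nonsingular: "open {a. nonsingular a}"
  unfolding open_dist
proof clarify
  fix a assume "nonsingular a"
  then obtain c r where c: "c > 0" "r > 0" "\<And>b z. dist b a < r \<Longrightarrow> c * norm z \<le> norm (prod b z)"
    using nonsingular_bounded_below by blast
  have "z = 0" if "dist b a < r" "prod b z = 0" for b z
    using c(1) c(3)[OF that(1), of z] that(2) by (simp add: mult_le_0_iff)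
  with c(2) show "\<exists>r>0. \<forall>b. dist b a < r \<longrightarrow> b \<in> {a. nonsingular a}"
    unfolding nonsingular_def by blast
qed

lemma nonsingular_solvable:
  assumes "nonsingular a"
  shows "\<exists>z. prod a z = w"
proof -
  have "linear (prod a)"
    using bounded_linear_right by (rule bounded_linear.linear)
  moreover from this have "inj (prod a)"
    using assms by (auto simp: linear_injective_0 nonsingular_def)
  ultimately have "surj (prod a)"
    using linear_injective_imp_surjective by blast
  then show ?thesis by (metis surjD)
qed

text \<open>\<open>prod (a s) (z s - z\<^sub>0) = C s - prod (a s) z\<^sub>0\<close> tends to 0, and
  the lower bound near \<open>a\<^sub>0\<close> passes this on to
  \<open>z s - z\<^sub>0\<close>.\<close>

lemma tendsto_solution:
  assumes ns: "nonsingular a\<^sub>0" and a: "(a \<longlongrightarrow> a\<^sub>0) F" and C: "(C \<longlongrightarrow> prod a\<^sub>0 z\<^sub>0) F"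
    and eq: "eventually (\<lambda>s. prod (a s) (z s) = C s) F"
  shows "(z \<longlongrightarrow> z\<^sub>0) F"
proof -
  obtain c r where c: "c > 0" "r > 0" "\<And>a z. dist a a\<^sub>0 < r \<Longrightarrow> c * norm z \<le> norm (prod a z)"
    using nonsingular_bounded_below[OF ns] by blast
  have "((\<lambda>s. C s - prod (a s) z\<^sub>0) \<longlongrightarrow> prod a\<^sub>0 z\<^sub>0 - prod a\<^sub>0 z\<^sub>0) F"
    by (intro tendsto_diff C tendsto a tendsto_const)
  then have lim: "((\<lambda>s. norm (C s - prod (a s) z\<^sub>0) / c) \<longlongrightarrow> 0) F"
    by (intro tendsto_divide_zero tendsto_norm_zero) simp
  have "eventually (\<lambda>s. dist (a s) a\<^sub>0 < r) F"
    using a c(2) by (rule tendstoD)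
  with eq have "eventually (\<lambda>s. norm (z s - z\<^sub>0) \<le> norm (C s - prod (a s) z\<^sub>0) / c) F"
  proof eventually_elim
    case (elim s)
    then show ?case
      using c(1) c(3)[of "a s" "z s - z\<^sub>0"] by (simp add: diff_right field_simps)
  qed
  then have "((\<lambda>s. z s - z\<^sub>0) \<longlongrightarrow> 0) F"
    using lim by (rule Lim_null_comparison)
  then show ?thesis by (simp add: LIM_zero_iff)
qed

lemma continuous_on_solution:
  assumes "continuous_on S a" "continuous_on S C"
    and "\<And>p. p \<in> S \<Longrightarrow> nonsingular (a p)" "\<And>p. p \<in> S \<Longrightarrow> prod (a p) (z p) = C p"
  shows "continuous_on S z"
  unfolding continuous_on_def
proof
  fix p assume p: "p \<in> S"
  show "(z \<longlongrightarrow> z p) (at p within S)"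
  proof (rule tendsto_solution)
    show "nonsingular (a p)" using p by (rule assms(3))
    show "(a \<longlongrightarrow> a p) (at p within S)"
      using assms(1) p by (simp add: continuous_on_def)
    show "(C \<longlongrightarrow> prod (a p) (z p)) (at p within S)"
      using assms(2) p unfolding assms(4)[OF p] by (simp add: continuous_on_def)
    show "\<forall>\<^sub>F q in at p within S. prod (a q) (z q) = C q"
      using assms(4) by (simp add: eventually_at_filter)
  qed
qed

text \<open>Differentiability of \<open>z\<close> is a result: its difference quotients at
  \<open>p\<close> solve equations with coefficients tending to \<open>a p\<close>, so
  \<open>tendsto_solution\<close> yields their limit \<open>z'\<close>.\<close>

lemma has_pd_solution:
  assumes S: "open S" "p \<in> S"
    and ns: "\<And>q. q \<in> S \<Longrightarrow> nonsingular (a q)" and eq: "\<And>q. q \<in> S \<Longrightarrow> prod (a q) (z q) = C q"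
    and a: "has_pd e a a' p" and C: "has_pd e C C' p" and z': "prod (a p) z' = C' - prod a' (z p)"
  shows "has_pd e z z' p"
  unfolding has_pd_def has_vector_derivative_iff_slope
proof (rule tendsto_solution)
  show "nonsingular (a p)" using S ns by simp
  have "((\<lambda>s. a (p + s *\<^sub>R e)) \<longlongrightarrow> a (p + 0 *\<^sub>R e)) (at 0)"
    using has_vector_derivative_continuous[OF a[unfolded has_pd_def]] by (rule isContD)
  then show "((\<lambda>s. a (p + s *\<^sub>R e)) \<longlongrightarrow> a p) (at 0)" by simp
  \<comment> \<open>With \<open>z p\<close> frozen the difference vanishes at \<open>p\<close>, so
    its slope is just the quotient below.\<close>
  have "has_pd e (\<lambda>q. C q - prod (a q) (z p)) (C' - prod a' (z p)) p"
    using has_pd_diff[OF C has_pd[OF a has_pd_const]] by (simp add: zero_right)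
  then show "((\<lambda>s. (C (p + s *\<^sub>R e) - prod (a (p + s *\<^sub>R e)) (z p)) /\<^sub>R s) \<longlongrightarrow> prod (a p) z') (at 0)"
    using eq[OF S(2)] by (simp add: has_pd_def has_vector_derivative_iff_slope z')
  show "\<forall>\<^sub>F s in at 0. prod (a (p + s *\<^sub>R e)) ((z (p + s *\<^sub>R e) - z (p + 0 *\<^sub>R e)) /\<^sub>R s) =
      (C (p + s *\<^sub>R e) - prod (a (p + s *\<^sub>R e)) (z p)) /\<^sub>R s"
    using eventually_line[OF S, of e]
  proof eventually_elim
    case (elim s)
    then show ?case
      using eq[OF elim] by (simp add: scaleR_right diff_right)
  qed
qed

text \<open>A derivative of the solution solves an equation with the same coefficient \<open>a\<close>, whose right-hand side
  \<open>\<partial>C - prod (\<partial>a) z\<close> involves only \<open>z\<close> itself, so that induction on \<open>k\<close> applies.\<close>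

lemma Ck_on_solution:
  assumes S: "open S" and ns: "\<And>p. p \<in> S \<Longrightarrow> nonsingular (a p)"
    and "\<And>p. p \<in> S \<Longrightarrow> prod (a p) (z p) = C p" "Ck_on k a S" "Ck_on k C S"
  shows "Ck_on k z S"
  using assms(3-)
proof (induction k arbitrary: z C)
  case 0
  then show ?case
    unfolding Ck_on.simps by (rule continuous_on_solution[OF _ _ ns, rotated 3])
next
  case (Suc k)
  \<comment> \<open>The factor -1 lets \<open>Ck_on_add\<close> and a bounded linear map handle the
    difference.\<close>
  let ?R = "\<lambda>e p. pd e C p + (- 1) *\<^sub>R prod (pd e a p) (z p)"
  define z' where "z' e p = (SOME w. prod (a p) w = ?R e p)" for e p
  have z': "prod (a p) (z' e p) = ?R e p" if "p \<in> S" for e p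
    unfolding z'_def using nonsingular_solvable[OF ns[OF that]] by (rule someI_ex)
  show ?case
  proof (rule Ck_on_SucI[OF S])
    show "continuous_on S z"
      by (rule continuous_on_solution[OF Ck_on_continuous[OF Suc.prems(2)]
            Ck_on_continuous[OF Suc.prems(3)] ns Suc.prems(1)])
    show "has_pd e z (z' e p) p" if "e \<in> axes" "p \<in> S" for e p
    proof (rule has_pd_solution[OF S that(2) ns Suc.prems(1)])
      show "has_pd e a (pd e a p) p" "has_pd e C (pd e C p) p"
        by (rule Ck_on_has_pd[OF _ that], fact)+
      show "prod (a p) (z' e p) = pd e C p - prod (pd e a p) (z p)"
        using z'[OF that(2)] by simp
    qed
    fix e assume e: "e \<in> axes"
    \<comment> \<open>The first use of the induction hypothesis, for \<open>z\<close>, gives the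
      right-hand side class k; the second use is for \<open>z' e\<close>.\<close>
    have "Ck_on k z S"
      by (rule Suc.IH[OF Suc.prems(1) Ck_on_SucD[OF Suc.prems(2)] Ck_on_SucD[OF Suc.prems(3)]])
    then have "Ck_on k (?R e) S"
      by (intro Ck_on_add[OF S] bounded_linear.Ck_on[OF bounded_linear_scaleR_right S] Ck_on[OF S]
          Ck_on_pd[OF Suc.prems(2) e] Ck_on_pd[OF Suc.prems(3) e])
    then show "Ck_on k (z' e) S"
      by (intro Suc.IH[OF z'] Ck_on_SucD[OF Suc.prems(2)])
  qed
qed

end

section \<open>Matrix calculus\<close>

lemma bounded_bilinear_matrix_mult:
  "bounded_bilinear ((**) :: complex^'n^'m \<Rightarrow> complex^'p^'n \<Rightarrow> complex^'p^'m)"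
  unfolding bilinear_conv_bounded_bilinear[symmetric] bilinear_def
  by (auto intro!: linearI simp: matrix_matrix_mult_def vec_eq_iff algebra_simps sum.distrib scaleR_sum_right)

interpretation mm: bounded_bilinear "(**) :: complex^'n^'m \<Rightarrow> complex^'p^'n \<Rightarrow> complex^'p^'m"
  by (rule bounded_bilinear_matrix_mult)

lemmas matrix_expand = mm.add_left mm.add_right mm.diff_left mm.diff_right mm.minus_left mm.minus_right
  mm.scaleR_left mm.scaleR_right mm.zero_left mm.zero_right

lemma cscale_mult_left: "(c *\<^sub>c A) ** B = c *\<^sub>c (A ** B)"
  by (simp add: cscale_def matrix_matrix_mult_def vec_eq_iff sum_distrib_left mult.assoc)

lemma cscale_mult_right: "A ** (c *\<^sub>c B) = c *\<^sub>c (A ** B)"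
  by (simp add: cscale_def matrix_matrix_mult_def vec_eq_iff sum_distrib_left mult.left_commute)

lemma cscale_cscale: "c *\<^sub>c d *\<^sub>c A = (c * d) *\<^sub>c A"
  by (simp add: cscale_def vec_eq_iff)

lemma cscale_diff: "c *\<^sub>c (A - B) = c *\<^sub>c A - c *\<^sub>c B"
  by (simp add: cscale_def vec_eq_iff algebra_simps)

lemma cscale_minus: "c *\<^sub>c (- A) = - (c *\<^sub>c A)"
  by (simp add: cscale_def vec_eq_iff)

lemma cscale_minus_left: "(- c) *\<^sub>c A = - (c *\<^sub>c A)"
  by (simp add: cscale_def vec_eq_iff)

lemma cscale_of_real: "complex_of_real r *\<^sub>c A = r *\<^sub>R A"
  by (simp add: cscale_def vec_eq_iff scaleR_conv_of_real[where 'a = complex])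

lemma cscale_half: "(1 / 2) *\<^sub>c A = (1 / 2) *\<^sub>R A"
  using cscale_of_real[of "1 / 2"] by simp

lemma diagonal_pm1_involution:
  assumes "diagonal_pm1 A"
  shows "A ** A = mat 1"
proof -
  have "(\<Sum>k\<in>UNIV. A $ i $ k * A $ k $ j) = (if i = j then 1 else 0)" for i j
  proof -
    have "(\<Sum>k\<in>UNIV. A $ i $ k * A $ k $ j) = A $ i $ i * A $ i $ j"
      using assms by (subst sum.remove[of _ i]) (auto simp: diagonal_pm1_def intro!: sum.neutral)
    moreover have "A $ i $ i = 1 \<or> A $ i $ i = - 1" "i \<noteq> j \<Longrightarrow> A $ i $ j = 0"
      using assms by (simp_all add: diagonal_pm1_def)
    ultimately show ?thesis by auto
  qed
  then show ?thesis
    by (simp add: matrix_matrix_mult_def mat_def vec_eq_iff)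
qed

lemma diagonal_pm1_block_J: "diagonal_pm1 block_J"
  by (auto simp: diagonal_pm1_def block_J_def split: sum.splits)

lemma matrix_inv_inverse:
  fixes A :: "complex^'n^'n"
  assumes "invertible A"
  shows "A ** matrix_inv A = mat 1" "matrix_inv A ** A = mat 1"
proof -
  have "A ** matrix_inv A = mat 1 \<and> matrix_inv A ** A = mat 1"
    using assms unfolding matrix_inv_def invertible_def by (rule someI_ex)
  then show "A ** matrix_inv A = mat 1" "matrix_inv A ** A = mat 1" by auto
qed

interpretation mult: euclidean_bilinear "(**) :: complex^'n^'n \<Rightarrow> complex^'n^'n \<Rightarrow> complex^'n^'n"
  by (simp add: euclidean_bilinear_def bounded_bilinear_matrix_mult)

text \<open>A solution \<open>Y\<close> of \<open>X ** Y = mat 1\<close> is also a left inverse, as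
  \<open>X\<close> annihilates \<open>Y ** X - mat 1\<close>. With \<open>open_nonsingular\<close>,
  invertibility is an open condition.\<close>

lemma mult_nonsingular_iff: "mult.nonsingular X \<longleftrightarrow> invertible X"
proof
  assume X: "mult.nonsingular X"
  then obtain Y where Y: "X ** Y = mat 1"
    using mult.nonsingular_solvable by blast
  have "X ** (Y ** X - mat 1) = 0"
    by (simp add: matrix_expand matrix_mul_assoc Y)
  then have "Y ** X - mat 1 = 0"
    using X unfolding mult.nonsingular_def by blast
  with Y show "invertible X" by (auto simp: invertible_def)
next
  assume "invertible X"
  then obtain Y where "Y ** X = mat 1" by (auto simp: invertible_def)
  then show "mult.nonsingular X"
    unfolding mult.nonsingular_def
  proof (intro allI impI)
    fix Z assume "X ** Z = 0"
    then have "Y ** X ** Z = 0"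
      by (simp add: matrix_expand flip: matrix_mul_assoc)
    with \<open>Y ** X = mat 1\<close> show "Z = 0" by simp
  qed
qed

lemma bounded_bilinear_sylvester:
  "bounded_bilinear (\<lambda>(ab :: (complex^'n^'n) \<times> (complex^'n^'n)) Y. Y ** fst ab - snd ab ** Y)"
  unfolding bilinear_conv_bounded_bilinear[symmetric] bilinear_def
  by (auto intro!: linearI simp: matrix_expand algebra_simps)

interpretation sylv: euclidean_bilinear
  "\<lambda>(ab :: (complex^'n^'n) \<times> (complex^'n^'n)) Y. Y ** fst ab - snd ab ** Y"
  by (simp add: euclidean_bilinear_def bounded_bilinear_sylvester)

lemma sylv_nonsingular:
  "spectrum A \<inter> spectrum B = {} \<Longrightarrow> sylv.nonsingular (A, B)"
  using sylvester_homogeneous by (auto simp: sylv.nonsingular_def)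

lemma sylvester_unique:
  fixes A B Y Z :: "complex^'n^'n"
  assumes "spectrum A \<inter> spectrum B = {}" "Y ** A - B ** Y = Z ** A - B ** Z"
  shows "Y = Z"
proof -
  have "(Y - Z) ** A = B ** (Y - Z)"
    using assms(2) by (simp add: matrix_expand algebra_simps)
  then show ?thesis
    using sylvester_homogeneous[OF assms(1)] by fastforce
qed

lemma sylvester_ex1:
  fixes A B C :: "complex^'n^'n"
  assumes "spectrum A \<inter> spectrum B = {}"
  shows "\<exists>!Y. is_sylvester_solution A B C Y"
proof -
  obtain Y where "Y ** A - B ** Y = C"
    using sylv.nonsingular_solvable[OF sylv_nonsingular[OF assms], of C] by auto
  then show ?thesis
    unfolding is_sylvester_solution_def
    by (intro ex1I[of _ Y]) (auto intro: sylvester_unique[OF assms])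
qed

text \<open>With \<open>XA - BX = C\<close>, \<open>A\<^sub>x = [J, A] A / 2\<close> and \<open>B\<^sub>x = B [J, B] / 2\<close>, the right-hand side is twice
  the inhomogeneity of the Sylvester equation for \<open>X\<^sub>x\<close>, whence \<open>X\<^sub>x = N / 2\<close>.\<close>

lemma sylvester_x_derivative:
  fixes A B C X J N :: "complex^'n^'n"
  assumes JC: "J ** C = C ** J" and XA: "X ** A = B ** X + C"
  defines "N \<equiv> B ** J ** X - X ** J ** A + C ** J"
  shows "N ** A - B ** N =
    - (X ** (J ** A ** A - A ** J ** A)) + (B ** J ** B - B ** B ** J) ** X"
proof -
  have "J ** (C ** Z) = C ** (J ** Z)" "X ** (A ** Z) = B ** (X ** Z) + C ** Z" for Z :: "complex^'n^'n"
    by (simp_all add: matrix_mul_assoc JC XA matrix_expand)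
  then show ?thesis
    by (simp add: N_def matrix_expand matrix_mul_assoc[symmetric] XA JC algebra_simps)
qed

text \<open>Multiply \<open>XA\<close> by \<open>W\<close> from both sides. The trailing
  \<open>Z\<close> makes this a rewrite rule for right-nested products, which eliminates
  \<open>B\<close>.\<close>

lemma inverse_sylvester:
  fixes A B C X W Z :: "complex^'n^'n"
  assumes XA: "X ** A = B ** X + C" and XW: "X ** W = mat 1" and WX: "W ** X = mat 1"
  shows "W ** (B ** Z) = A ** (W ** Z) - W ** (C ** (W ** Z))"
proof -
  have "W ** (X ** A) ** W = W ** (B ** X + C) ** W"
    by (simp add: XA)
  moreover have "W ** (X ** A) ** W = A ** W"
    by (simp add: matrix_mul_assoc WX)
  moreover have "W ** (B ** X + C) ** W = W ** B ** (X ** W) + W ** C ** W"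
    by (simp add: matrix_expand matrix_mul_assoc)
  ultimately have "W ** B = A ** W - W ** C ** W"
    by (simp add: XW)
  then show ?thesis
    by (simp add: matrix_expand matrix_mul_assoc)
qed

text \<open>The middle factor is twice X_x, so this is -2 W_x, expressed without \<open>B\<close>
  and without derivatives.\<close>

lemma inverse_x_derivative:
  fixes A B C X J W :: "complex^'n^'n"
  assumes XA: "X ** A = B ** X + C" and XW: "X ** W = mat 1" and WX: "W ** X = mat 1"
  shows "W ** (B ** J ** X - X ** J ** A + C ** J) ** W =
    A ** W ** J - W ** C ** W ** J - J ** (A ** W) + W ** C ** J ** W"
proof -
  have "W ** (X ** Z) = Z" for Z :: "complex^'n^'n"
    by (simp add: matrix_mul_assoc WX)
  then show ?thesis
    by (simp add: matrix_expand matrix_mul_assoc[symmetric] inverse_sylvester[OF assms] XW)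
qed

text \<open>The middle factor is i times X_t, so this is -i times W_t; \<open>Wy\<close> absorbs the
  product of \<open>Xy\<close> with its neighbours \<open>W\<close>.\<close>

lemma inverse_t_derivative:
  fixes A B C X W Ay Xy Wy :: "complex^'n^'n"
  assumes XA: "X ** A = B ** X + C" and XW: "X ** W = mat 1" and WX: "W ** X = mat 1"
    and Wy: "Wy = - (W ** Xy ** W)"
  shows "W ** (X ** Ay - B ** Xy) ** W = Ay ** W + A ** Wy - W ** C ** Wy"
proof -
  have "W ** (X ** Z) = Z" for Z :: "complex^'n^'n"
    by (simp add: matrix_mul_assoc WX)
  then show ?thesis
    by (simp add: Wy matrix_expand matrix_mul_assoc[symmetric] inverse_sylvester[OF XA XW WX] XW)
qed

text \<open>The equation for \<open>\<phi>\<close> stripped of the outer factors \<open>U\<^sub>0\<close> and \<open>V\<^sub>0\<close>: here \<open>F'\<close> stands for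
  \<open>(A W)\<^sub>y\<close> and \<open>M\<close> for \<open>- \<i> W\<^sub>t\<close>.\<close>

lemma reduced_equation:
  fixes C J F' M N W Wy :: "complex^'n^'n"
  assumes JJ: "J ** J = mat 1" and JC: "J ** C = C ** J"
  defines "M \<equiv> F' - W ** C ** Wy" and "N \<equiv> W - J ** W ** J"
  shows "M - J ** M ** J =
    - (J ** (F' ** J - (Wy ** C ** W + W ** C ** Wy) ** J - J ** F' + Wy ** C ** J ** W + W ** C ** J ** Wy))
    + (J ** Wy ** C ** J ** N - N ** C ** Wy)"
proof -
  have "J ** (J ** Z) = Z" "J ** (C ** Z) = C ** (J ** Z)" for Z :: "complex^'n^'n"
    by (simp_all add: matrix_mul_assoc JJ JC)
  then show ?thesis
    by (simp add: M_def N_def matrix_expand matrix_mul_assoc[symmetric] algebra_simps)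
qed

section \<open>The solution formula\<close>

theorem proposition6p3:
  fixes J \<phi>\<^sub>0 :: "complex^('m1::finite + 'm2::finite)^('m1 + 'm2)"
    and \<phi> :: "point \<Rightarrow> complex^('m1 + 'm2)^('m1 + 'm2)"
    and JJ :: "complex^'n^'n"
    and P Q X :: "point \<Rightarrow> complex^'n^'n"
    and U\<^sub>0 :: "complex^'n^('m1 + 'm2)"
    and V\<^sub>0 :: "complex^('m1 + 'm2)^'n"
    and D S :: "point set"
  assumes J: "J = block_J"
    and JJ: "diagonal_pm1 JJ"
    and D: "open D"
    and \<phi>\<^sub>0: "commutator J \<phi>\<^sub>0 = 0"
    and P_smooth: "smooth_on D P"
    and Q_smooth: "smooth_on D Q"
    and P_t: "\<And>p. p \<in> D \<Longrightarrow> \<i> *\<^sub>c pd_t P p + pd_y P p ** JJ ** P p = 0"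
    and P_x: "\<And>p. p \<in> D \<Longrightarrow> pd_x P p = (1/2) *\<^sub>c ((JJ ** P p ** JJ - P p) ** P p)"
    and Q_t: "\<And>p. p \<in> D \<Longrightarrow> \<i> *\<^sub>c pd_t Q p + Q p ** JJ ** pd_y Q p = 0"
    and Q_x: "\<And>p. p \<in> D \<Longrightarrow> pd_x Q p = (1/2) *\<^sub>c (Q p ** (Q p - JJ ** Q p ** JJ))"
    and disjoint: "\<And>p. p \<in> D \<Longrightarrow> spectrum (JJ ** P p) \<inter> spectrum (Q p ** JJ) = {}"
    and U\<^sub>0: "J ** U\<^sub>0 = U\<^sub>0 ** JJ"
    and V\<^sub>0: "JJ ** V\<^sub>0 = V\<^sub>0 ** J"
    and X: "\<And>p. p \<in> D \<Longrightarrow> X p = sylvester_solution (JJ ** P p) (Q p ** JJ) (V\<^sub>0 ** U\<^sub>0)"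
    and \<phi>: "\<And>p. \<phi> p = \<phi>\<^sub>0 + J ** U\<^sub>0 ** matrix_inv (X p) ** V\<^sub>0"
    and S: "S = {p \<in> D. invertible (X p)}"
  shows "(\<forall>p\<in>D. \<exists>!Y. is_sylvester_solution (JJ ** P p) (Q p ** JJ) (V\<^sub>0 ** U\<^sub>0) Y) \<and>
    open S \<and> smooth_on S \<phi> \<and>
    (\<forall>p\<in>S. (- \<i> / 2) *\<^sub>c commutator J (pd_t \<phi> p) =
       pd_y (pd_x \<phi>) p +
       (1/2) *\<^sub>c (pd_y \<phi> p ** J ** commutator J (\<phi> p) - commutator J (\<phi> p) ** J ** pd_y \<phi> p))"
proof -
  define A where "A p = JJ ** P p" for p
  define B where "B p = Q p ** JJ" for p
  define C where "C = V\<^sub>0 ** U\<^sub>0"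
  define W where "W p = matrix_inv (X p)" for p
  have JJ2: "JJ ** JJ = mat 1"
    using JJ by (rule diagonal_pm1_involution)
  then have JJ2': "JJ ** (JJ ** Z) = Z" for Z :: "complex^'n^'n"
    by (simp add: matrix_mul_assoc)
  have J2: "J ** J = mat 1"
    unfolding J by (rule diagonal_pm1_involution[OF diagonal_pm1_block_J])
  \<comment> \<open>\<open>JJ\<close> passes through \<open>V\<^sub>0\<close> as \<open>J\<close>
    and through \<open>U\<^sub>0\<close> as \<open>JJ\<close> again.\<close>
  have JC: "JJ ** C = C ** JJ"
    by (metis C_def U\<^sub>0 V\<^sub>0 matrix_mul_assoc)
  have disj: "spectrum (A p) \<inter> spectrum (B p) = {}" if "p \<in> D" for p
    using disjoint[OF that] by (simp add: A_def B_def)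
  have ex1: "\<exists>!Y. is_sylvester_solution (A p) (B p) C Y" if "p \<in> D" for p
    using sylvester_ex1[OF disj[OF that]] .
  have sylvester: "X p ** A p - B p ** X p = C" if "p \<in> D" for p
    using theI'[OF ex1[OF that]] X[OF that]
    by (simp add: sylvester_solution_def is_sylvester_solution_def A_def B_def C_def)
  then have XA: "X p ** A p = B p ** X p + C" if "p \<in> D" for p
    using that by (metis diff_add_cancel add.commute)

  \<comment> \<open>Smoothness of the solution and openness of the set where it is
    invertible\<close>
  have Ck_P: "Ck_on k P D" and Ck_Q: "Ck_on k Q D" for k
    using P_smooth Q_smooth by (auto simp: smooth_on_def)
  have Ck_A: "Ck_on k A D" and Ck_B: "Ck_on k B D" for k
    unfolding A_def B_def
    by (intro bounded_linear.Ck_on[OF mm.bounded_linear_right D] Ck_P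
        bounded_linear.Ck_on[OF mm.bounded_linear_left D] Ck_Q)+
  have Ck_AB: "Ck_on k (\<lambda>p. (A p, B p)) D" for k
  proof -
    \<comment> \<open>The pair is a sum of linear embeddings of \<open>A\<close> and
      \<open>B\<close>.\<close>
    have "Ck_on k (\<lambda>p. (A p, 0) + (0, B p)) D"
      by (intro Ck_on_add[OF D] bounded_linear.Ck_on[of "\<lambda>a. (a, 0)", OF _ D Ck_A]
          bounded_linear.Ck_on[of "\<lambda>b. (0, b)", OF _ D Ck_B]
          bounded_linear_Pair bounded_linear_ident bounded_linear_zero)
    then show ?thesis by simp
  qed
  have Ck_X: "Ck_on k X D" for k
    by (rule sylv.Ck_on_solution[OF D _ _ Ck_AB Ck_on_const[OF D, of _ C]])
      (simp_all add: sylv_nonsingular disj sylvester)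
  have S_alt: "S = X -` {Y. mult.nonsingular Y} \<inter> D"
    using S by (auto simp: mult_nonsingular_iff)
  have "continuous_on D X"
    using Ck_X Ck_on_continuous by blast
  then have open_S: "open S"
    unfolding S_alt
    using continuous_on_open_vimage[OF D, THEN iffD1] mult.open_nonsingular by blast
  have SD: "S \<subseteq> D" using S by blast
  have XW: "X p ** W p = mat 1" and WX: "W p ** X p = mat 1" if "p \<in> S" for p
    using that matrix_inv_inverse[of "X p"] by (auto simp: S W_def)
  \<comment> \<open>On \<open>S\<close>, \<open>W\<close> solves the linear equation
    \<open>X ** W = mat 1\<close>, whose coefficient \<open>X\<close> is smooth.\<close>
  have Ck_W: "Ck_on k W S" for k
    by (rule mult.Ck_on_solution[OF open_S _ _ Ck_on_subset[OF Ck_X SD] Ck_on_const[OF open_S, of _ "mat 1"]])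
      (use S in \<open>simp_all add: mult_nonsingular_iff XW\<close>)
  have \<phi>_eq: "\<phi> = (\<lambda>p. \<phi>\<^sub>0 + J ** U\<^sub>0 ** W p ** V\<^sub>0)"
    by (simp add: fun_eq_iff \<phi> W_def)
  have "Ck_on k \<phi> S" for k
    unfolding \<phi>_eq
    by (intro Ck_on_add[OF open_S] Ck_on_const[OF open_S] Ck_W
        bounded_linear.Ck_on[OF mm.bounded_linear_left open_S]
        bounded_linear.Ck_on[OF mm.bounded_linear_right open_S])
  then have smooth_\<phi>: "smooth_on S \<phi>"
    by (simp add: smooth_on_def)

  \<comment> \<open>First derivatives of \<open>A\<close>, \<open>B\<close>, \<open>X\<close>,
    \<open>W\<close> and \<open>\<phi>\<close>\<close>
  let ?ex = "(1, 0, 0) :: point" and ?ey = "(0, 1, 0) :: point" and ?et = "(0, 0, 1) :: point"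
  have axes: "?ex \<in> axes" "?ey \<in> axes" "?et \<in> axes"
    by (simp_all add: axes_def)
  have dP: "has_pd e P (pd e P p) p" and dQ: "has_pd e Q (pd e Q p) p"
    and dA: "has_pd e A (pd e A p) p" and dB: "has_pd e B (pd e B p) p"
    and dX: "has_pd e X (pd e X p) p" if "p \<in> D" "e \<in> axes" for e p
    using Ck_on_has_pd[of 0] that Ck_P Ck_Q Ck_A Ck_B Ck_X by blast+
  have dW: "has_pd e W (pd e W p) p" if "p \<in> S" "e \<in> axes" for e p
    using Ck_on_has_pd[OF Ck_W] that by blast
  have pd_A: "pd e A p = JJ ** pd e P p" and pd_B: "pd e B p = pd e Q p ** JJ"
    if "p \<in> D" "e \<in> axes" for e p
    unfolding A_def B_def
    by (rule has_pdD, rule bounded_linear.has_pd[OF mm.bounded_linear_right] bounded_linear.has_pd[OF mm.bounded_linear_left],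
        rule dP[OF that] dQ[OF that])+
  \<comment> \<open>Since \<open>JJ\<close> is an involution, the equations for \<open>P\<close> and
    \<open>Q\<close> turn into equations for \<open>A\<close> and \<open>B\<close>, such as A_x =
    [JJ, A] A / 2 and i A_t = - A_y A.\<close>
  have P_A: "P p = JJ ** A p" and Q_B: "Q p = B p ** JJ" for p
    by (simp_all add: A_def B_def JJ2' JJ2 flip: matrix_mul_assoc)

  have A_x: "pd ?ex A p = (1/2) *\<^sub>R (JJ ** A p ** A p - A p ** JJ ** A p)" if "p \<in> D" for p
    using P_x[OF that] pd_A[OF that axes(1)]
    by (simp add: pd_x_eq cscale_half P_A matrix_expand JJ2' matrix_mul_assoc[symmetric])
  have B_x: "pd ?ex B p = (1/2) *\<^sub>R (B p ** JJ ** B p - B p ** B p ** JJ)" if "p \<in> D" for p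
    using Q_x[OF that] pd_B[OF that axes(1)]
    by (simp add: pd_x_eq cscale_half Q_B matrix_expand JJ2 JJ2' matrix_mul_assoc[symmetric])
  have A_t: "\<i> *\<^sub>c pd ?et A p = - (pd ?ey A p ** A p)" if "p \<in> D" for p
  proof -
    have "\<i> *\<^sub>c pd_t P p = - (pd_y P p ** JJ ** P p)"
      using P_t[OF that] by (simp add: eq_neg_iff_add_eq_0)
    then show ?thesis
      by (simp add: pd_A[OF that] axes A_def pd_t_eq pd_y_eq matrix_expand matrix_mul_assoc[symmetric]
          flip: cscale_mult_right)
  qed
  have B_t: "\<i> *\<^sub>c pd ?et B p = - (B p ** pd ?ey B p)" if "p \<in> D" for p
  proof -
    have "\<i> *\<^sub>c pd_t Q p = - (Q p ** JJ ** pd_y Q p)"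
      using Q_t[OF that] by (simp add: eq_neg_iff_add_eq_0)
    then show ?thesis
      by (simp add: pd_B[OF that] axes B_def pd_t_eq pd_y_eq matrix_expand matrix_mul_assoc[symmetric]
          flip: cscale_mult_left)
  qed

  have X_pd: "pd e X p ** A p - B p ** pd e X p = pd e B p ** X p - X p ** pd e A p"
    if "p \<in> D" "e \<in> axes" for e p
  proof -
    have "has_pd e (\<lambda>q. X q ** A q - B q ** X q)
        ((X p ** pd e A p + pd e X p ** A p) - (B p ** pd e X p + pd e B p ** X p)) p"
      using that by (intro has_pd_diff mm.has_pd dX dA dB)
    then have "has_pd e (\<lambda>q. C)
        ((X p ** pd e A p + pd e X p ** A p) - (B p ** pd e X p + pd e B p ** X p)) p"
      using has_pd_cong[where f = "\<lambda>q. X q ** A q - B q ** X q" and g = "\<lambda>q. C", OF D that(1) sylvester]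
      by blast
    from has_pdD[OF this] has_pdD[OF has_pd_const]
    have "(X p ** pd e A p + pd e X p ** A p) - (B p ** pd e X p + pd e B p ** X p) = 0"
      by metis
    then show ?thesis by (simp add: algebra_simps)
  qed
  \<comment> \<open>The candidate satisfies the equation \<open>X_pd\<close> for the derivative by
    \<open>sylvester_x_derivative\<close>; uniqueness identifies the two.\<close>
  have X_x: "pd ?ex X p = (1/2) *\<^sub>R (B p ** JJ ** X p - X p ** JJ ** A p + C ** JJ)" if "p \<in> D" for p
    by (rule sylvester_unique[OF disj[OF that]])
      (simp add: X_pd that axes A_x B_x mm.scaleR_left mm.scaleR_right
        sylvester_x_derivative[OF JC XA[OF that]] flip: scaleR_diff_right)
  have X_t: "\<i> *\<^sub>c pd ?et X p = X p ** pd ?ey A p - B p ** pd ?ey X p" if "p \<in> D" for p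
  proof (rule sylvester_unique[OF disj[OF that]])
    have "(\<i> *\<^sub>c pd ?et X p) ** A p - B p ** (\<i> *\<^sub>c pd ?et X p) =
        \<i> *\<^sub>c (pd ?et B p ** X p - X p ** pd ?et A p)"
      by (simp add: X_pd that axes cscale_mult_left cscale_mult_right flip: cscale_diff)
    also have "\<dots> = X p ** (pd ?ey A p ** A p) - B p ** pd ?ey B p ** X p"
    proof -
      have "\<i> *\<^sub>c (pd ?et B p ** X p) = (\<i> *\<^sub>c pd ?et B p) ** X p"
        "\<i> *\<^sub>c (X p ** pd ?et A p) = X p ** (\<i> *\<^sub>c pd ?et A p)"
        by (simp_all add: cscale_mult_left cscale_mult_right)
      then show ?thesis
        by (simp add: cscale_diff A_t B_t that matrix_expand)
    qed
    also have "\<dots> = (X p ** pd ?ey A p - B p ** pd ?ey X p) ** A p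
        - B p ** (X p ** pd ?ey A p - B p ** pd ?ey X p)"
    proof -
      \<comment> \<open>Multiplying the equation for X_y by \<open>B\<close> removes X_y, after
        which the two terms in B X A_y cancel.\<close>
      have "B p ** (pd ?ey X p ** A p - B p ** pd ?ey X p) =
          B p ** (pd ?ey B p ** X p - X p ** pd ?ey A p)"
        by (simp add: X_pd that axes)
      then show ?thesis
        by (simp add: matrix_expand matrix_mul_assoc algebra_simps)
    qed
    finally show "(\<i> *\<^sub>c pd ?et X p) ** A p - B p ** (\<i> *\<^sub>c pd ?et X p) = \<dots>" .
  qed
  have W_pd: "pd e W p = - (W p ** pd e X p ** W p)" if "p \<in> S" "e \<in> axes" for e p
  proof -
    have "has_pd e (\<lambda>q. X q ** W q) (X p ** pd e W p + pd e X p ** W p) p"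
      using that SD by (intro mm.has_pd dX dW) auto
    then have "has_pd e (\<lambda>q. mat 1 :: complex^'n^'n) (X p ** pd e W p + pd e X p ** W p) p"
      using has_pd_cong[where f = "\<lambda>q. X q ** W q" and g = "\<lambda>q. mat 1", OF open_S that(1) XW]
      by blast
    from has_pdD[OF this] has_pdD[OF has_pd_const]
    have "X p ** pd e W p + pd e X p ** W p = 0"
      by metis
    then have "W p ** (X p ** pd e W p + pd e X p ** W p) = 0"
      by (simp add: matrix_expand)
    then show ?thesis
      by (simp add: matrix_expand matrix_mul_assoc WX that eq_neg_iff_add_eq_0)
  qed
  have \<phi>_pd: "pd e \<phi> p = U\<^sub>0 ** JJ ** pd e W p ** V\<^sub>0" if "p \<in> S" "e \<in> axes" for e p
  proof -
    have "has_pd e \<phi> (0 + J ** U\<^sub>0 ** pd e W p ** V\<^sub>0) p"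
      unfolding \<phi>_eq
      by (intro has_pd_add has_pd_const bounded_linear.has_pd[OF mm.bounded_linear_left]
          bounded_linear.has_pd[OF mm.bounded_linear_right] dW that)
    then show ?thesis by (simp add: has_pdD U\<^sub>0)
  qed
  \<comment> \<open>On \<open>S\<close> this is -2 W_x. As it contains no derivatives, its
    y-derivative needs only first derivatives of \<open>A\<close> and \<open>W\<close>.\<close>
  define G where "G p = A p ** W p ** JJ - W p ** C ** W p ** JJ - JJ ** (A p ** W p)
      + W p ** C ** JJ ** W p" for p
  have \<phi>_x: "pd ?ex \<phi> p = (- (1/2)) *\<^sub>R (U\<^sub>0 ** JJ ** G p ** V\<^sub>0)" if "p \<in> S" for p
  proof -
    have "p \<in> D" using that SD by blast
    then have "pd ?ex W p = (- (1/2)) *\<^sub>R G p"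
      by (simp add: W_pd that axes X_x mm.scaleR_left mm.scaleR_right G_def
          inverse_x_derivative[OF XA XW[OF that] WX[OF that]])
    then show ?thesis
      by (simp add: \<phi>_pd that axes matrix_expand)
  qed

  \<comment> \<open>Verification of the equation for \<open>\<phi>\<close>\<close>
  show ?thesis
  proof (intro conjI ballI)
    show "\<exists>!Y. is_sylvester_solution (JJ ** P p) (Q p ** JJ) (V\<^sub>0 ** U\<^sub>0) Y" if "p \<in> D" for p
      using ex1[OF that] by (simp add: A_def B_def C_def)
    show "open S" "smooth_on S \<phi>" by fact+
    fix p assume p: "p \<in> S"
    then have pD: "p \<in> D" using SD by blast
    let ?W = "W p" and ?Wy = "pd ?ey W p" and ?F' = "pd ?ey A p ** W p + A p ** pd ?ey W p"
    let ?M = "?F' - ?W ** C ** ?Wy" and ?N = "?W - JJ ** ?W ** JJ"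
    let ?G' = "?F' ** JJ - (?Wy ** C ** ?W + ?W ** C ** ?Wy) ** JJ - JJ ** ?F'
      + ?Wy ** C ** JJ ** ?W + ?W ** C ** JJ ** ?Wy"
    \<comment> \<open>These rules move \<open>J\<close> inwards past \<open>U\<^sub>0\<close> and
      \<open>V\<^sub>0\<close>, where it becomes \<open>JJ\<close>. The trailing \<open>Z\<close>
      suits right-nested products; \<open>JJV\<close> and \<open>JCV\<close> are rectangular
      instances of square rules.\<close>
    have VU: "V\<^sub>0 ** (U\<^sub>0 ** Z) = C ** Z" for Z :: "complex^('m1 + 'm2)^'n"
      by (simp add: C_def matrix_mul_assoc)
    have JU: "J ** (U\<^sub>0 ** Z) = U\<^sub>0 ** (JJ ** Z)" for Z :: "complex^('m1 + 'm2)^'n"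
      by (simp add: matrix_mul_assoc U\<^sub>0)
    have VJ: "V\<^sub>0 ** J = JJ ** V\<^sub>0" and VJ': "V\<^sub>0 ** (J ** Z) = JJ ** (V\<^sub>0 ** Z)"
      for Z :: "complex^('m1 + 'm2)^('m1 + 'm2)"
      by (simp_all add: matrix_mul_assoc V\<^sub>0)
    have JJV: "JJ ** (JJ ** Z) = Z" for Z :: "complex^('m1 + 'm2)^'n"
      by (simp add: matrix_mul_assoc JJ2)
    have JCV: "JJ ** (C ** Z) = C ** (JJ ** Z)" for Z :: "complex^('m1 + 'm2)^'n"
      by (simp add: matrix_mul_assoc JC)
    note sandwich = matrix_expand VU JU VJ VJ' JJV JCV matrix_mul_assoc[symmetric]

    have comm_\<phi>: "commutator J (\<phi> p) = U\<^sub>0 ** ?N ** V\<^sub>0"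
    proof -
      have "J ** \<phi>\<^sub>0 = \<phi>\<^sub>0 ** J"
        using \<phi>\<^sub>0 by (simp add: commutator_def)
      then show ?thesis
        by (simp add: commutator_def \<phi>_eq sandwich)
    qed
    have "has_pd ?ey G ?G' p"
    proof -
      have AW: "has_pd ?ey (\<lambda>q. A q ** W q) ?F' p"
        using mm.has_pd[OF dA[OF pD axes(2)] dW[OF p axes(2)]] by (simp add: add.commute)
      have WC: "has_pd ?ey (\<lambda>q. W q ** C) (?Wy ** C) p"
        by (intro bounded_linear.has_pd[OF mm.bounded_linear_left] dW p axes)
      have WCW: "has_pd ?ey (\<lambda>q. W q ** C ** W q) (?Wy ** C ** ?W + ?W ** C ** ?Wy) p"
        using mm.has_pd[OF WC dW[OF p axes(2)]] by (simp add: add.commute)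
      have WCJ: "has_pd ?ey (\<lambda>q. W q ** C ** JJ) (?Wy ** C ** JJ) p"
        by (intro bounded_linear.has_pd[OF mm.bounded_linear_left] WC)
      have "has_pd ?ey (\<lambda>q. W q ** C ** JJ ** W q) (?Wy ** C ** JJ ** ?W + ?W ** C ** JJ ** ?Wy) p"
        using mm.has_pd[OF WCJ dW[OF p axes(2)]] by (simp add: add.commute)
      then have "has_pd ?ey G (?F' ** JJ - (?Wy ** C ** ?W + ?W ** C ** ?Wy) ** JJ - JJ ** ?F'
        + (?Wy ** C ** JJ ** ?W + ?W ** C ** JJ ** ?Wy)) p"
        unfolding G_def
        by (intro has_pd_add has_pd_diff bounded_linear.has_pd[OF mm.bounded_linear_left]
            bounded_linear.has_pd[OF mm.bounded_linear_right] AW WCW)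
      then show ?thesis by (simp only: add.assoc)
    qed
    then have "has_pd ?ey (\<lambda>q. (- (1/2)) *\<^sub>R (U\<^sub>0 ** JJ ** G q ** V\<^sub>0))
        ((- (1/2)) *\<^sub>R (U\<^sub>0 ** JJ ** ?G' ** V\<^sub>0)) p"
      by (intro bounded_linear.has_pd[OF bounded_linear_scaleR_right]
          bounded_linear.has_pd[OF mm.bounded_linear_left] bounded_linear.has_pd[OF mm.bounded_linear_right])
    \<comment> \<open>The formula \<open>\<phi>_x\<close> holds on all of the open set
      \<open>S\<close>, so it may be differentiated in y.\<close>
    then have \<phi>_xy: "pd_y (pd_x \<phi>) p = (1/2) *\<^sub>R (U\<^sub>0 ** (- (JJ ** ?G')) ** V\<^sub>0)"
      using pd_cong[where f = "pd ?ex \<phi>" and e = ?ey, OF open_S p \<phi>_x]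
      by (simp add: pd_x_eq pd_y_eq has_pdD mm.minus_left mm.minus_right matrix_mul_assoc)
    have \<phi>_y: "pd_y \<phi> p = U\<^sub>0 ** JJ ** ?Wy ** V\<^sub>0"
      by (simp add: pd_y_eq \<phi>_pd p axes)
    have "\<i> *\<^sub>c (W p ** pd ?et X p ** W p) = W p ** (\<i> *\<^sub>c pd ?et X p) ** W p"
      by (simp add: cscale_mult_left cscale_mult_right)
    then have "\<i> *\<^sub>c pd ?et W p = - ?M"
      using inverse_t_derivative[OF XA[OF pD] XW[OF p] WX[OF p] W_pd[OF p axes(2)], of "pd ?ey A p"]
      by (simp add: W_pd p axes cscale_minus X_t[OF pD])
    then have M: "(- \<i>) *\<^sub>c pd ?et W p = ?M"
      by (simp only: cscale_minus_left minus_minus)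
    show "(- \<i> / 2) *\<^sub>c commutator J (pd_t \<phi> p) =
       pd_y (pd_x \<phi>) p +
       (1/2) *\<^sub>c (pd_y \<phi> p ** J ** commutator J (\<phi> p) - commutator J (\<phi> p) ** J ** pd_y \<phi> p)"
    proof -
      have "commutator J (pd_t \<phi> p) = U\<^sub>0 ** (pd ?et W p - JJ ** pd ?et W p ** JJ) ** V\<^sub>0"
        by (simp add: pd_t_eq \<phi>_pd p axes commutator_def sandwich)
      \<comment> \<open>Splitting off -i lets it combine with W_t to \<open>?M\<close>.\<close>
      then have "(- \<i> / 2) *\<^sub>c commutator J (pd_t \<phi> p) =
          (1/2) *\<^sub>c (- \<i>) *\<^sub>c (U\<^sub>0 ** (pd ?et W p - JJ ** pd ?et W p ** JJ) ** V\<^sub>0)"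
        by (simp add: cscale_cscale)
      also have "\<dots> = (1/2) *\<^sub>R (U\<^sub>0 ** (?M - JJ ** ?M ** JJ) ** V\<^sub>0)"
        unfolding M[symmetric] cscale_half
        by (simp only: cscale_mult_left cscale_mult_right flip: cscale_diff)
      also have "?M - JJ ** ?M ** JJ = - (JJ ** ?G') + (JJ ** ?Wy ** C ** JJ ** ?N - ?N ** C ** ?Wy)"
        by (rule reduced_equation[OF JJ2 JC])
      also have "(1/2) *\<^sub>R (U\<^sub>0 ** \<dots> ** V\<^sub>0) = pd_y (pd_x \<phi>) p
          + (1/2) *\<^sub>R (U\<^sub>0 ** (JJ ** ?Wy ** C ** JJ ** ?N - ?N ** C ** ?Wy) ** V\<^sub>0)"
        unfolding \<phi>_xy by (simp only: mm.add_left mm.add_right scaleR_add_right)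
      \<comment> \<open>The inner \<open>V\<^sub>0 ** J ** U\<^sub>0\<close> becomes
        \<open>C ** JJ\<close>; in the second product this \<open>JJ\<close> cancels the one in
        front of \<open>?Wy\<close>.\<close>
      also have "U\<^sub>0 ** (JJ ** ?Wy ** C ** JJ ** ?N - ?N ** C ** ?Wy) ** V\<^sub>0 =
          pd_y \<phi> p ** J ** commutator J (\<phi> p) - commutator J (\<phi> p) ** J ** pd_y \<phi> p"
        unfolding comm_\<phi> \<phi>_y by (simp add: sandwich)
      finally show ?thesis by (simp add: cscale_half)
    qed
  qed
qed

end
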